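(* Let $f\in\Gamma_0(\mathcal X)$. Assume there is a constant $\gamma>0$ such that for all $(x,y)\in\mathcal Z$, $$\|\partial f(x)+A^Ty\|_0+\|Ax-b\|\ \ge\ \gamma\,\mathrm{dist}(x,\mathcal X^\star)+\gamma\,\mathrm{dist}(y,\mathcal Y^\star).$$ Then for all $z=(x,y)\in\mathcal Z$, $$f(x)-f_{\mathrm{opt}}\ \le\ \frac{2}{\gamma}\,\mathcal K(z)+\|y\|\sqrt{\mathcal K(z)} .$$
   Context: $\mathcal X,\mathcal Y$ are finite-dimensional Euclidean spaces, $\mathcal Z=\mathcal X\times\mathcal Y$, $z=(x,y)$. $\Gamma_0(\mathcal X)$ is the set of proper, lower semicontinuous, convex functions $\mathcal X\to\mathbb R\cup\{+\infty\}$. $A:\mathcal X\to\mathcal Y$ is linear with adjoint $A^T$, and $b\in\mathcal Y$. The problem is $\min_x f(x)$ subject to $Ax=b$, with optimal value $f_{\mathrm{opt}}$ and Lagrangian $\mathcal L(x,y)=f(x)+\langle Ax-b,y\rangle$. Standing assumption: $\mathcal L$ has a saddle point. $\mathcal Z^\star=\mathcal X^\star\times\mathcal Y^\star$ denotes the set of saddle points ($\mathcal X^\star$ the primal parts, $\mathcal Y^\star$ the dual parts). For a set $\mathcal Q$, $\|\mathcal Q\|_0=\min\{\|q\|: q\in\mathcal Q\}$, with value $+\infty$ if $\mathcal Q=\emptyset$. The Karush-Kuhn-Tucker error is $\mathcal K(z)=\|\partial f(x)+A^Ty\|_0^2+\|Ax-b\|^2$. $\mathrm{dist}(u,S)=\inf_{s\in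 S}\|u-s\|$. *)

theory Defs
  imports "HOL-Analysis.Analysis"
begin

definition proper_fun :: "('a \<Rightarrow> ereal) \<Rightarrow> bool" where
  "proper_fun f \<longleftrightarrow> (\<forall>x. f x \<noteq> -\<infinity>) \<and> (\<exists>x. f x \<noteq> \<infinity>)"

definition lower_semicontinuous :: "('a::topological_space \<Rightarrow> ereal) \<Rightarrow> bool" where
  "lower_semicontinuous f \<longleftrightarrow> (\<forall>x. f x \<le> Liminf (at x) f)"

(* Only used for functions that never take the value -\<infinity>, so the sum on the right is
   never \<infinity> + -\<infinity>.  In ereal, 0 * \<infinity> = 0, so the cases u = 0 and v = 0 impose nothing. *)
definition ereal_convex :: "('a::real_vector \<Rightarrow> ereal) \<Rightarrow> bool" where
  "ereal_convex f \<longleftrightarrow> (\<forall>x y u v. 0 \<le> u \<longrightarrow> 0 \<le> v \<longrightarrow> u + v = 1 \<longrightarrow>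
     f (u *\<^sub>R x + v *\<^sub>R y) \<le> ereal u * f x + ereal v * f y)"

definition Gamma0 :: "('a::euclidean_space \<Rightarrow> ereal) set" where
  "Gamma0 = {f. proper_fun f \<and> lower_semicontinuous f \<and> ereal_convex f}"

(* For proper f this is empty wherever f x = \<infinity>. *)
definition subdifferential :: "('a::real_inner \<Rightarrow> ereal) \<Rightarrow> 'a \<Rightarrow> 'a set" where
  "subdifferential f x = {g. \<forall>x'. f x + ereal (g \<bullet> (x' - x)) \<le> f x'}"

(* The infimum over the empty set is \<infinity>; for closed nonempty Q it is a minimum
   (min_norm_attained), and the sets it is applied to are closed
   (closed_subdifferential_translate). *)
definition min_norm :: "'a::real_normed_vector set \<Rightarrow> ereal" where
  "min_norm Q = (INF q\<in>Q. ereal (norm q))"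

definition lagrangian ::
    "('a \<Rightarrow> ereal) \<Rightarrow> ('a \<Rightarrow> 'b::real_inner) \<Rightarrow> 'b \<Rightarrow> 'a \<Rightarrow> 'b \<Rightarrow> ereal" where
  "lagrangian f A b x y = f x + ereal ((A x - b) \<bullet> y)"

definition saddle_points ::
    "('a \<Rightarrow> ereal) \<Rightarrow> ('a \<Rightarrow> 'b::real_inner) \<Rightarrow> 'b \<Rightarrow> ('a \<times> 'b) set" where
  "saddle_points f A b = {(xs, ys). \<forall>x y.
     lagrangian f A b xs y \<le> lagrangian f A b xs ys \<and>
     lagrangian f A b xs ys \<le> lagrangian f A b x ys}"

definition primal_solutions ::
    "('a \<Rightarrow> ereal) \<Rightarrow> ('a \<Rightarrow> 'b::real_inner) \<Rightarrow> 'b \<Rightarrow> 'a set" where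
  "primal_solutions f A b = fst ` saddle_points f A b"

definition dual_solutions ::
    "('a \<Rightarrow> ereal) \<Rightarrow> ('a \<Rightarrow> 'b::real_inner) \<Rightarrow> 'b \<Rightarrow> 'b set" where
  "dual_solutions f A b = snd ` saddle_points f A b"

definition opt_value :: "('a \<Rightarrow> ereal) \<Rightarrow> ('a \<Rightarrow> 'b) \<Rightarrow> 'b \<Rightarrow> ereal" where
  "opt_value f A b = (INF x\<in>{x. A x = b}. f x)"

definition dual_residual ::
    "('a::euclidean_space \<Rightarrow> ereal) \<Rightarrow> ('a \<Rightarrow> 'b::euclidean_space) \<Rightarrow> 'a \<Rightarrow> 'b \<Rightarrow> ereal" where
  "dual_residual f A x y = min_norm ((\<lambda>g. g + adjoint A y) ` subdifferential f x)"

definition kkt_error ::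
    "('a::euclidean_space \<Rightarrow> ereal) \<Rightarrow> ('a \<Rightarrow> 'b::euclidean_space) \<Rightarrow> 'b \<Rightarrow> 'a \<times> 'b \<Rightarrow> ereal"
  where
  "kkt_error f A b = (\<lambda>(x, y). (dual_residual f A x y)\<^sup>2 + ereal ((norm (A x - b))\<^sup>2))"

(* Only used for nonnegative arguments. *)
definition ereal_sqrt :: "ereal \<Rightarrow> ereal" where
  "ereal_sqrt t = (if t = \<infinity> then \<infinity> else ereal (sqrt (real_of_ereal t)))"

lemma min_norm_attained:
  fixes Q :: "'a::euclidean_space set"
  assumes "closed Q" "Q \<noteq> {}"
  shows "\<exists>q\<in>Q. min_norm Q = ereal (norm q) \<and> (\<forall>p\<in>Q. norm q \<le> norm p)"
proof -
  obtain q where q: "q \<in> Q" "\<And>p. p \<in> Q \<Longrightarrow> dist 0 q \<le> dist 0 p"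
    using distance_attains_inf[OF assms, of 0] by metis
  have "min_norm Q = ereal (norm q)"
    unfolding min_norm_def
    by (rule antisym) (use q in \<open>auto intro!: INF_lower INF_greatest\<close>)
  then show ?thesis using q by auto
qed

lemma closed_subdifferential_translate:
  fixes f :: "'a::real_inner \<Rightarrow> ereal"
  shows "closed ((\<lambda>g. g + c) ` subdifferential f x)"
proof -
  have "closed {g. f x + ereal (g \<bullet> (x' - x)) \<le> f x'}" for x'
  proof (cases "\<bar>f x\<bar> = \<infinity> \<or> \<bar>f x'\<bar> = \<infinity>")
    case True
    then show ?thesis by (cases "f x"; cases "f x'") auto
  next
    case False
    then obtain r s where [simp]: "f x = ereal r" "f x' = ereal s"
      by (cases "f x"; cases "f x'") auto
    show ?thesis by (auto intro!: closed_Collect_le continuous_intros)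
  qed
  then have "closed (subdifferential f x)"
    unfolding subdifferential_def by (rule closed_Collect_all)
  then have "closed ((\<lambda>g. c + g) ` subdifferential f x)"
    by (rule closed_translation)
  then show ?thesis by (simp add: add.commute)
qed

end

theory Submission
  imports Defs
begin

text \<open>
  Let \<open>g\<close> be the subgradient at \<open>x\<close> that attains the dual residual, and put \<open>d = g + A\<^sup>T y\<close>.
  For every primal solution \<open>s\<close>, the subgradient inequality and \<open>A s = b\<close> give
  \<open>f x - f s \<le> \<langle>d, x - s\<rangle> - \<langle>y, A x - b\<rangle>\<close>. Taking the infimum over \<open>s\<close> bounds the first term by
  \<open>\<parallel>d\<parallel> dist(x, X\<^sup>*)\<close>, and the error bound at \<open>(x, y)\<close> bounds the distance by
  \<open>(\<parallel>d\<parallel> + \<parallel>A x - b\<parallel>) / \<gamma>\<close>.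
\<close>

lemma proper_fun_obtain_finite:
  assumes "proper_fun f"
  obtains x r where "f x = ereal r"
  using assms unfolding proper_fun_def by (metis ereal_cases)

text \<open>Minimality in the primal variable, tested at a point where \<open>f\<close> is finite,
  rules out \<infinity>.\<close>

lemma saddle_points_finite:
  assumes "proper_fun f" and "(s, t) \<in> saddle_points f A b"
  obtains r where "f s = ereal r"
proof -
  obtain x c where x: "f x = ereal c"
    using assms(1) by (rule proper_fun_obtain_finite)
  have "lagrangian f A b s t \<le> lagrangian f A b x t"
    using assms(2) by (auto simp: saddle_points_def)
  then have "f s \<noteq> \<infinity>"
    by (auto simp: lagrangian_def x)
  moreover have "f s \<noteq> -\<infinity>"
    using assms(1) by (simp add: proper_fun_def)
  ultimately show thesis
    using that by (cases "f s") auto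
qed

text \<open>With \<open>f s\<close> finite, the Lagrangian is affine in the dual variable with slope
  \<open>A s - b\<close>, so it has a maximum only if the slope vanishes. A dual step from
  \<open>t\<close> along the slope itself shows this.\<close>

lemma saddle_points_feasible:
  assumes "proper_fun f" and "(s, t) \<in> saddle_points f A b"
  shows "A s = b"
proof -
  obtain r where r: "f s = ereal r"
    using assms by (rule saddle_points_finite)
  have "lagrangian f A b s (t + (A s - b)) \<le> lagrangian f A b s t"
    using assms(2) unfolding saddle_points_def by blast
  then have "(A s - b) \<bullet> (A s - b) \<le> 0"
    by (simp add: lagrangian_def r inner_add_right)
  then show ?thesis
    by (metis inner_ge_zero inner_eq_zero_iff order_antisym right_minus_eq)
qed

text \<open>At feasible points the coupling term is zero, so the Lagrangian reduces to
  \<open>f\<close> and primal minimality compares values of \<open>f\<close>.\<close>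

lemma saddle_points_opt_value:
  assumes "proper_fun f" and "(s, t) \<in> saddle_points f A b"
  shows "opt_value f A b = f s"
  unfolding opt_value_def
proof (rule antisym)
  have s: "A s = b"
    using assms by (rule saddle_points_feasible)
  then show "(INF x\<in>{x. A x = b}. f x) \<le> f s"
    by (auto intro: INF_lower)
  show "f s \<le> (INF x\<in>{x. A x = b}. f x)"
  proof (rule INF_greatest)
    fix x assume "x \<in> {x. A x = b}"
    moreover have "lagrangian f A b s t \<le> lagrangian f A b x t"
      using assms(2) by (auto simp: saddle_points_def)
    ultimately show "f s \<le> f x"
      by (simp add: lagrangian_def s zero_ereal_def[symmetric])
  qed
qed

lemma subdifferential_finite:
  assumes "proper_fun f" and "g \<in> subdifferential f x"
  obtains r where "f x = ereal r"
proof -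
  obtain z c where z: "f z = ereal c"
    using assms(1) by (rule proper_fun_obtain_finite)
  have "f x + ereal (g \<bullet> (z - x)) \<le> f z"
    using assms(2) by (auto simp: subdifferential_def)
  then have "f x \<noteq> \<infinity>"
    by (auto simp: z)
  moreover have "f x \<noteq> -\<infinity>"
    using assms(1) by (simp add: proper_fun_def)
  ultimately show thesis
    using that by (cases "f x") auto
qed

lemma dual_residual_empty:
  assumes "subdifferential f x = {}"
  shows "dual_residual f A x y = \<infinity>"
  by (simp add: dual_residual_def min_norm_def assms top_ereal_def)

lemma dual_residual_attained:
  assumes "subdifferential f x \<noteq> {}"
  obtains g where "g \<in> subdifferential f x"
    and "dual_residual f A x y = ereal (norm (g + adjoint A y))"
  using min_norm_attained[OF closed_subdifferential_translate[of "adjoint A y" f x]] assms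
  unfolding dual_residual_def by auto

text \<open>Passes to the infimum over \<open>S\<close> without choosing a nearest point.
  Nonemptiness matters because \<open>infdist\<close> to the empty set is 0 by default.\<close>

lemma le_mult_infdist:
  assumes "S \<noteq> {}" and "0 \<le> k" and "\<And>s. s \<in> S \<Longrightarrow> c \<le> k * dist x s"
  shows "c \<le> k * infdist x S"
proof (cases "k = 0")
  case True
  then show ?thesis using assms by force
next
  case False
  then have "c / k \<le> dist x s" if "s \<in> S" for s
    using assms(2) assms(3)[OF that] by (simp add: divide_le_eq mult.commute)
  then have "c / k \<le> infdist x S"
    using assms(1) by (auto simp: infdist_def intro!: cINF_greatest)
  then show ?thesis
    using False assms(2) by (simp add: divide_le_eq mult.commute)
qed

theorem theorem2:
  fixes f :: "'a::euclidean_space \<Rightarrow> ereal"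
    and A :: "'a \<Rightarrow> 'b::euclidean_space"
    and b :: 'b
    and \<gamma> :: real
  assumes "f \<in> Gamma0"
    and "linear A"
    and "saddle_points f A b \<noteq> {}"
    and "\<gamma> > 0"
    and "\<And>x y. dual_residual f A x y + ereal (norm (A x - b))
           \<ge> ereal (\<gamma> * infdist x (primal_solutions f A b)
                    + \<gamma> * infdist y (dual_solutions f A b))"
  shows "\<forall>x y. f x - opt_value f A b
           \<le> ereal (2 / \<gamma>) * kkt_error f A b (x, y)
             + ereal (norm y) * ereal_sqrt (kkt_error f A b (x, y))"
proof (intro allI)
  fix x y
  have proper: "proper_fun f"
    using assms(1) by (simp add: Gamma0_def)
  show "f x - opt_value f A b
           \<le> ereal (2 / \<gamma>) * kkt_error f A b (x, y)
             + ereal (norm y) * ereal_sqrt (kkt_error f A b (x, y))"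
  proof (cases "subdifferential f x = {}")
    case True
    \<comment> \<open>The term with 2 / \<gamma> alone makes the bound infinite; the other one is 0
      when y = 0, as 0 * \<infinity> = 0.\<close>
    have "kkt_error f A b (x, y) = \<infinity>"
      by (simp add: kkt_error_def dual_residual_empty[OF True] power2_eq_square)
    then show ?thesis
      using assms(4) by (simp add: ereal_sqrt_def)
  next
    case False
    then obtain g where g: "g \<in> subdifferential f x"
      and res: "dual_residual f A x y = ereal (norm (g + adjoint A y))"
      by (rule dual_residual_attained)
    define d where "d = g + adjoint A y"
    define p where "p = A x - b"
    define K where "K = (norm d)\<^sup>2 + (norm p)\<^sup>2"
    have kkt: "kkt_error f A b (x, y) = ereal K"
      by (simp add: kkt_error_def res K_def d_def p_def)
    obtain c where c: "f x = ereal c"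
      using proper g by (rule subdifferential_finite)
    obtain s0 t0 where "(s0, t0) \<in> saddle_points f A b"
      using assms(3) by auto
    then obtain m where m: "opt_value f A b = ereal m"
      by (metis proper saddle_points_finite saddle_points_opt_value)
    \<comment> \<open>The term in \<open>y\<close> does not depend on the primal solution, so it
      moves to the left before the infimum is taken.\<close>
    have "c - m - norm y * norm p \<le> norm d * infdist x (primal_solutions f A b)"
    proof (rule le_mult_infdist)
      show "primal_solutions f A b \<noteq> {}"
        using assms(3) by (simp add: primal_solutions_def)
      fix s assume "s \<in> primal_solutions f A b"
      then obtain t where st: "(s, t) \<in> saddle_points f A b"
        by (auto simp: primal_solutions_def)
      have As: "A s = b" and fs: "f s = ereal m"
        using saddle_points_feasible[OF proper st] saddle_points_opt_value[OF proper st] m by simp_all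
      have "f x + ereal (g \<bullet> (s - x)) \<le> f s"
        using g by (auto simp: subdifferential_def)
      then have "c - m \<le> g \<bullet> (x - s)"
        by (simp add: c fs inner_diff_right)
      \<comment> \<open>Substitute \<open>g = d - adjoint A y\<close> and use
        \<open>A (x - s) = p\<close>, which holds by feasibility of \<open>s\<close>.\<close>
      also have "\<dots> = d \<bullet> (x - s) - p \<bullet> y"
        using adjoint_works[OF assms(2), of "x - s" y]
        by (simp add: d_def p_def inner_add_right linear_diff[OF assms(2)] As inner_commute)
      also have "\<dots> \<le> norm d * dist x s + norm y * norm p"
        using norm_cauchy_schwarz[of d "x - s"] norm_cauchy_schwarz[of "- p" y]
        by (simp add: dist_norm mult.commute)
      finally show "c - m - norm y * norm p \<le> norm d * dist x s"
        by simp
    qed simp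
    also have "\<dots> \<le> norm d * ((norm d + norm p) / \<gamma>)"
    proof (rule mult_left_mono)
      have "\<gamma> * infdist x (primal_solutions f A b) + \<gamma> * infdist y (dual_solutions f A b)
          \<le> norm d + norm p"
        using assms(5)[of x y] by (simp add: res d_def p_def)
      moreover have "0 \<le> \<gamma> * infdist y (dual_solutions f A b)"
        using assms(4) by (simp add: infdist_nonneg)
      ultimately show "infdist x (primal_solutions f A b) \<le> (norm d + norm p) / \<gamma>"
        using assms(4) by (simp add: le_divide_eq mult.commute)
    qed simp
    also have "\<dots> \<le> 2 / \<gamma> * K"
    proof -
      \<comment> \<open>Young's inequality bounds the cross term by \<open>K / 2\<close>, and the
        square of \<open>norm d\<close> is at most \<open>K\<close>.\<close>
      have "norm d * (norm d + norm p) \<le> 2 * K"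
        using sum_squares_bound[of "norm d" "norm p"]
          zero_le_power2[of "norm d"] zero_le_power2[of "norm p"]
        unfolding K_def power2_eq_square distrib_left by linarith
      then show ?thesis
        using assms(4) by (simp add: divide_right_mono)
    qed
    finally have "c - m \<le> 2 / \<gamma> * K + norm y * norm p"
      by simp
    also have "norm y * norm p \<le> norm y * sqrt K"
      by (intro mult_left_mono real_le_rsqrt) (simp_all add: K_def)
    finally show ?thesis
      by (simp add: kkt c m ereal_sqrt_def)
  qed
qed

end
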